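(* Let $(C,\le)$ be a causal set, let $n,r\ge1$ be integers, and let $\gamma=(x_0,\dots,x_{n+r})$ be a maximising geodesic of $C$. Let $0=m_0<m_1<\dots<m_k=n$ be integers with $m_i-m_{i-1}\ge r$ for all $1\le i\le k$, and let $\gamma_i:=(x_{m_{i-1}},x_{m_{i-1}+1},\dots,x_{m_i+r})$ be the corresponding subgeodesics. Let $K\in\mathbb R$ and $\alpha\in[0,1]$. (a) If $\kappa_r(\gamma_i)\ge K$ for all $1\le i\le k$, then $\kappa_r(\gamma)\ge K$. (b) If $\kappa_r^\alpha(\gamma_i)\ge K$ for all $1\le i\le k$, then $\kappa_r^\alpha(\gamma)\ge K$. (c) If $\kappa_r^{\mathrm{LLY}}(\gamma_i)\ge K$ for all $1\le i\le k$, then $\kappa_r^{\mathrm{LLY}}(\gamma)\ge K$.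
   Context: A causal set is a pair $(C,\le)$ where $\le$ is a partial order on the set $C$ such that every causal diamond $J(x,z)=\{y\in C:x\le y\le z\}$ is finite. Write $x\ll y$ if $x\le y$ and $x\ne y$. The time separation is $\tau(x,y)=\max\{m: x=z_0\ll z_1\ll\dots\ll z_m=y\}$ if $x\le y$, and $\tau(x,y)=0$ otherwise. A chain $x_0\ll\dots\ll x_m$ is a (maximising) geodesic if $m=\tau(x_0,x_m)$. For finitely supported probability measures $\mu,\nu$ on $C$, $\ell_1(\mu,\nu)=\max_\pi\sum_{a,b}\pi(a,b)\tau(a,b)$ over couplings $\pi$ of $\mu,\nu$ with $\pi(a,b)=0$ whenever $a\not\le b$ ($-\infty$ if none exist). Curvatures: for integers $n\ge r\ge1$, a maximising geodesic $\gamma=(x_0,\dots,x_{n+r})$, and $\alpha\in[0,1]$, put $x=x_0$, $y=x_n$, $N_x=|J(x,x_r)|$, $N_y=|J(y,x_{n+r})|$; $\mu_x$ is the uniform probability measure on $J(x,x_r)$, $\mu_y$ the uniform probability measure on $J(y,x_{n+r})$, and $$\mu_x^\alpha=\alpha\delta_x+\frac{1-\alpha}{N_x-1}\sum_{z\in J(x,x_r)\setminus\{x\}}\delta_z,\qquad \mu_y^\alpha=\alpha\delta_y+\frac{1-\alpha}{N_y-1}\sum_{z\in J(y,x_{n+r})\setminus\{y\}}\delta_z.$$ Then $\kappa_r(\gamma)=\frac{\ell_1(\mu_x,\mu_y)}{\tau(x,y)}-1$, $\kappa_r^\alpha(\gamma)=\frac{\ell_1(\mu_x^\alpha,\mu_y^\alpha)}{\tau(x,y)}-1$,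 $\kappa_r^{\mathrm{LLY}}(\gamma)=\lim_{\alpha\to1}\frac{\kappa_r^\alpha(\gamma)}{1-\alpha}$. (For the subgeodesic $\gamma_i$ of the statement, these are taken with $n$ replaced by $m_i-m_{i-1}$, i.e. with base points $x_{m_{i-1}}$ and $x_{m_i}$.) *)

theory Defs
  imports "HOL-Probability.Probability"
begin

text \<open>The order of a causal set \<open>(C, R)\<close> is the relation \<open>R\<close>, with \<open>(x, y) \<in> R\<close> for \<open>x \<le> y\<close>.
  Since \<open>R\<close> is reflexive on \<open>C\<close> and contained in \<open>C \<times> C\<close>, we have \<open>Field R = C\<close>, so the notions
  below depend on \<open>R\<close> only.\<close>

definition diamond :: "'a rel \<Rightarrow> 'a \<Rightarrow> 'a \<Rightarrow> 'a set" where
  "diamond R x z = {y. (x, y) \<in> R \<and> (y, z) \<in> R}"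

definition causal_set :: "'a set \<Rightarrow> 'a rel \<Rightarrow> bool" where
  "causal_set C R \<longleftrightarrow> partial_order_on C R \<and> (\<forall>x\<in>C. \<forall>z\<in>C. finite (diamond R x z))"

text \<open>Chains of length \<open>l\<close> are functions on \<open>nat\<close> of which only the values at \<open>0, \<dots>, l\<close> matter.\<close>

definition chain :: "'a rel \<Rightarrow> nat \<Rightarrow> (nat \<Rightarrow> 'a) \<Rightarrow> bool" where
  "chain R l z \<longleftrightarrow> (\<forall>i\<le>l. z i \<in> Field R) \<and> (\<forall>i<l. (z i, z (Suc i)) \<in> R \<and> z i \<noteq> z (Suc i))"

definition tau :: "'a rel \<Rightarrow> 'a \<Rightarrow> 'a \<Rightarrow> nat" where
  "tau R x y = (if (x, y) \<in> R then Max {l. \<exists>z. chain R l z \<and> z 0 = x \<and> z l = y} else 0)"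

definition geodesic :: "'a rel \<Rightarrow> nat \<Rightarrow> (nat \<Rightarrow> 'a) \<Rightarrow> bool" where
  "geodesic R l \<gamma> \<longleftrightarrow> chain R l \<gamma> \<and> l = tau R (\<gamma> 0) (\<gamma> l)"

definition causal_couplings :: "'a rel \<Rightarrow> 'a pmf \<Rightarrow> 'a pmf \<Rightarrow> ('a \<times> 'a) pmf set" where
  "causal_couplings R \<mu> \<nu> =
     {\<pi>. map_pmf fst \<pi> = \<mu> \<and> map_pmf snd \<pi> = \<nu> \<and> (\<forall>a b. (a, b) \<notin> R \<longrightarrow> pmf \<pi> (a, b) = 0)}"

definition cost :: "'a rel \<Rightarrow> ('a \<times> 'a) pmf \<Rightarrow> real" where
  "cost R \<pi> = measure_pmf.expectation \<pi> (\<lambda>(a, b). real (tau R a b))"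

text \<open>The supremum of the empty set is \<open>-\<infinity>\<close> in \<open>ereal\<close>; for finitely supported measures that admit
  a causal coupling the supremum is a maximum, see \<open>ell1_attained\<close>.\<close>

definition ell1 :: "'a rel \<Rightarrow> 'a pmf \<Rightarrow> 'a pmf \<Rightarrow> ereal" where
  "ell1 R \<mu> \<nu> = (SUP \<pi>\<in>causal_couplings R \<mu> \<nu>. ereal (cost R \<pi>))"

text \<open>The measure that puts mass \<open>\<alpha>\<close> on \<open>x\<close> and distributes \<open>1 - \<alpha>\<close> uniformly on \<open>A - {x}\<close>.
  It is only meaningful for \<open>x \<in> A\<close>, \<open>A\<close> finite with at least two elements, and \<open>\<alpha> \<in> [0, 1]\<close>,
  see \<open>pmf_lazy\<close>.\<close>

definition lazy_pmf :: "real \<Rightarrow> 'a \<Rightarrow> 'a set \<Rightarrow> 'a pmf" where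
  "lazy_pmf \<alpha> x A =
     embed_pmf (\<lambda>z. \<alpha> * indicator {x} z + (1 - \<alpha>) / (real (card A) - 1) * indicator (A - {x}) z)"

definition kappa :: "'a rel \<Rightarrow> nat \<Rightarrow> nat \<Rightarrow> (nat \<Rightarrow> 'a) \<Rightarrow> ereal" where
  "kappa R r n \<gamma> =
     ell1 R (pmf_of_set (diamond R (\<gamma> 0) (\<gamma> r))) (pmf_of_set (diamond R (\<gamma> n) (\<gamma> (n + r))))
       / ereal (real (tau R (\<gamma> 0) (\<gamma> n))) - 1"

definition kappa_lazy :: "'a rel \<Rightarrow> nat \<Rightarrow> real \<Rightarrow> nat \<Rightarrow> (nat \<Rightarrow> 'a) \<Rightarrow> ereal" where
  "kappa_lazy R r \<alpha> n \<gamma> =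
     ell1 R (lazy_pmf \<alpha> (\<gamma> 0) (diamond R (\<gamma> 0) (\<gamma> r)))
            (lazy_pmf \<alpha> (\<gamma> n) (diamond R (\<gamma> n) (\<gamma> (n + r))))
       / ereal (real (tau R (\<gamma> 0) (\<gamma> n))) - 1"

text \<open>The measures exist for \<open>\<alpha> \<in> [0, 1]\<close> only, so the limit at 1 is one from the left.\<close>

definition kappa_LLY :: "'a rel \<Rightarrow> nat \<Rightarrow> nat \<Rightarrow> (nat \<Rightarrow> 'a) \<Rightarrow> ereal" where
  "kappa_LLY R r n \<gamma> = Lim (at_left 1) (\<lambda>\<alpha>. kappa_lazy R r \<alpha> n \<gamma> / ereal (1 - \<alpha>))"

definition subgeodesic :: "(nat \<Rightarrow> 'a) \<Rightarrow> nat \<Rightarrow> nat \<Rightarrow> 'a" where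
  "subgeodesic \<gamma> s = (\<lambda>j. \<gamma> (s + j))"

lemma nn_integral_count_space_support:
  fixes f :: "'a \<Rightarrow> real"
  assumes "finite A" "\<And>x. 0 \<le> f x" "\<And>x. x \<notin> A \<Longrightarrow> f x = 0"
  shows "(\<integral>\<^sup>+x. ennreal (f x) \<partial>count_space UNIV) = ennreal (sum f A)"
proof -
  have "(\<integral>\<^sup>+x. ennreal (f x) \<partial>count_space UNIV) = (\<Sum>x\<in>A. ennreal (f x))"
    using assms by (intro nn_integral_count_space') auto
  then show ?thesis using assms(2) by (simp add: sum_ennreal)
qed

lemma pmf_lazy:
  assumes A: "finite A" "x \<in> A" "2 \<le> card A" and \<alpha>: "0 \<le> \<alpha>" "\<alpha> \<le> 1"
  shows "pmf (lazy_pmf \<alpha> x A) z =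
    \<alpha> * indicator {x} z + (1 - \<alpha>) / (real (card A) - 1) * indicator (A - {x}) z"
proof -
  let ?f = "\<lambda>z. \<alpha> * indicator {x} z + (1 - \<alpha>) / (real (card A) - 1) * indicator (A - {x}) z :: real"
  have nn: "0 \<le> ?f z" for z using A \<alpha> by (auto simp: indicator_def)
  have "sum ?f A = \<alpha> + (\<Sum>z\<in>A - {x}. ?f z)"
    using A by (subst sum.remove[of A x]) auto
  also have "(\<Sum>z\<in>A - {x}. ?f z) = (\<Sum>z\<in>A - {x}. (1 - \<alpha>) / (real (card A) - 1))"
    by (rule sum.cong) auto
  also have "\<dots> = real (card A - 1) * ((1 - \<alpha>) / (real (card A) - 1))"
    using A by simp
  also have "\<dots> = 1 - \<alpha>" using A by (simp add: of_nat_diff)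
  finally have "sum ?f A = 1" by simp
  moreover have "(\<integral>\<^sup>+z. ennreal (?f z) \<partial>count_space UNIV) = ennreal (sum ?f A)"
    using A by (intro nn_integral_count_space_support nn) (auto simp: indicator_def)
  ultimately show ?thesis
    unfolding lazy_pmf_def by (subst pmf_embed_pmf) (use nn in auto)
qed

lemma ell1_attained:
  assumes fin: "finite (set_pmf \<mu>)" "finite (set_pmf \<nu>)" and ne: "causal_couplings R \<mu> \<nu> \<noteq> {}"
  shows "\<exists>\<pi>\<in>causal_couplings R \<mu> \<nu>. ell1 R \<mu> \<nu> = ereal (cost R \<pi>)"
proof -
  let ?S = "set_pmf \<mu>" and ?T = "set_pmf \<nu>"
  let ?P = "?S \<times> ?T"
  define B :: "('a \<times> 'a \<Rightarrow> real) set"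
    where "B = PiE UNIV (\<lambda>p. if p \<in> ?P \<inter> R then {0..1} else {0})"
  define W where "W = B \<inter> ((\<Inter>a. {f. (\<Sum>b\<in>?T. f (a, b)) = pmf \<mu> a}) \<inter>
                           (\<Inter>b. {f. (\<Sum>a\<in>?S. f (a, b)) = pmf \<nu> b}))"
  define J where "J = (\<lambda>f :: 'a \<times> 'a \<Rightarrow> real. \<Sum>p\<in>?P. f p * real (tau R (fst p) (snd p)))"
  have cont: "continuous_on X (\<lambda>f :: 'a \<times> 'a \<Rightarrow> real. f p)" for X p
    by (rule continuous_on_subset[OF continuous_on_product_coordinates]) simp
  have "compact B"
    unfolding B_def compactin_euclidean_iff[symmetric] euclidean_product_topology[symmetric]
    by (subst compactin_PiE) auto
  then have "compact W"
    unfolding W_def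
    by (intro compact_Int_closed closed_Int closed_INT ballI closed_Collect_eq
          continuous_on_sum continuous_on_const cont) auto
  moreover have "continuous_on W J"
    unfolding J_def by (intro continuous_intros cont)
  moreover have pmfW: "pmf \<pi> \<in> W \<and> cost R \<pi> = J (pmf \<pi>)" if \<pi>: "\<pi> \<in> causal_couplings R \<mu> \<nu>" for \<pi>
  proof -
    have m: "map_pmf fst \<pi> = \<mu>" "map_pmf snd \<pi> = \<nu>" and R: "\<And>a b. (a, b) \<notin> R \<Longrightarrow> pmf \<pi> (a, b) = 0"
      using \<pi> by (auto simp: causal_couplings_def)
    have supp: "set_pmf \<pi> \<subseteq> ?P" unfolding m[symmetric] by force
    have z0: "pmf \<pi> (a, b) = 0" if "a \<notin> ?S \<or> b \<notin> ?T" for a b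
      using supp that by (auto simp: pmf_eq_0_set_pmf)
    have "pmf \<mu> a = (\<Sum>b\<in>?T. pmf \<pi> (a, b))" for a
    proof -
      have "pmf \<mu> a = measure \<pi> (fst -` {a} \<inter> ?P)"
        unfolding m(1)[symmetric] pmf_map
        by (rule measure_pmf.finite_measure_eq_AE) (use supp m in \<open>auto simp: AE_measure_pmf_iff\<close>)
      also have "fst -` {a} \<inter> ?P = (if a \<in> ?S then Pair a ` ?T else {})" by auto
      also have "measure \<pi> \<dots> = (if a \<in> ?S then \<Sum>b\<in>?T. pmf \<pi> (a, b) else 0)"
        using fin by (auto simp: measure_measure_pmf_finite sum.reindex inj_on_def)
      also have "\<dots> = (\<Sum>b\<in>?T. pmf \<pi> (a, b))"
        by (simp add: z0)
      finally show ?thesis .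
    qed
    moreover have "pmf \<nu> b = (\<Sum>a\<in>?S. pmf \<pi> (a, b))" for b
    proof -
      have "pmf \<nu> b = measure \<pi> (snd -` {b} \<inter> ?P)"
        unfolding m(2)[symmetric] pmf_map
        by (rule measure_pmf.finite_measure_eq_AE) (use supp m in \<open>auto simp: AE_measure_pmf_iff\<close>)
      also have "snd -` {b} \<inter> ?P = (if b \<in> ?T then (\<lambda>a. (a, b)) ` ?S else {})" by auto
      also have "measure \<pi> \<dots> = (if b \<in> ?T then \<Sum>a\<in>?S. pmf \<pi> (a, b) else 0)"
        using fin by (auto simp: measure_measure_pmf_finite sum.reindex inj_on_def)
      also have "\<dots> = (\<Sum>a\<in>?S. pmf \<pi> (a, b))"
        by (simp add: z0)
      finally show ?thesis .
    qed
    moreover have "pmf \<pi> \<in> B"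
      unfolding B_def using supp R by (auto simp: pmf_le_1 pmf_eq_0_set_pmf)
    moreover have "cost R \<pi> = J (pmf \<pi>)"
      unfolding cost_def J_def using supp fin
      by (subst integral_measure_pmf_real[where A = ?P]) (auto simp: case_prod_beta mult.commute)
    ultimately show ?thesis by (auto simp: W_def)
  qed
  moreover have "W \<noteq> {}" using ne pmfW by blast
  ultimately obtain f where f: "f \<in> W" "\<And>g. g \<in> W \<Longrightarrow> J g \<le> J f"
    using continuous_attains_sup[of W J] by blast
  have fB: "f p \<in> (if p \<in> ?P \<inter> R then {0..1} else {0})" for p
    using f(1) by (simp only: W_def B_def PiE_UNIV_domain) blast
  have nn: "0 \<le> f p" and z: "p \<notin> ?P \<inter> R \<Longrightarrow> f p = 0" for p
    using fB[of p] by (simp_all split: if_splits)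
  have row: "(\<Sum>b\<in>?T. f (a, b)) = pmf \<mu> a" and col: "(\<Sum>a\<in>?S. f (a, b)) = pmf \<nu> b" for a b
    using f(1) by (auto simp: W_def)
  have "(\<Sum>p\<in>?P. f p) = (\<Sum>a\<in>?S. \<Sum>b\<in>?T. f (a, b))"
    by (simp add: sum.cartesian_product)
  also have "\<dots> = 1" using fin by (simp add: row sum_pmf_eq_1)
  finally have one: "sum f ?P = 1" .
  define \<pi> where "\<pi> = embed_pmf f"
  have p: "pmf \<pi> p = f p" for p
    unfolding \<pi>_def
    by (subst pmf_embed_pmf) (use nn z fin one in \<open>auto simp: nn_integral_count_space_support[of ?P]\<close>)
  have supp: "set_pmf \<pi> \<subseteq> ?P" using z by (auto simp: set_pmf_eq p)
  have "map_pmf fst \<pi> = \<mu>"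
  proof (rule pmf_eqI)
    fix a
    have "pmf (map_pmf fst \<pi>) a = measure \<pi> (Pair a ` ?T)"
      unfolding pmf_map
      by (rule measure_pmf.finite_measure_eq_AE) (use supp in \<open>auto simp: AE_measure_pmf_iff\<close>)
    also have "\<dots> = pmf \<mu> a"
      using fin by (simp add: measure_measure_pmf_finite sum.reindex inj_on_def p row)
    finally show "pmf (map_pmf fst \<pi>) a = pmf \<mu> a" .
  qed
  moreover have "map_pmf snd \<pi> = \<nu>"
  proof (rule pmf_eqI)
    fix b
    have "pmf (map_pmf snd \<pi>) b = measure \<pi> ((\<lambda>a. (a, b)) ` ?S)"
      unfolding pmf_map
      by (rule measure_pmf.finite_measure_eq_AE) (use supp in \<open>auto simp: AE_measure_pmf_iff\<close>)
    also have "\<dots> = pmf \<nu> b"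
      using fin by (simp add: measure_measure_pmf_finite sum.reindex inj_on_def p col)
    finally show "pmf (map_pmf snd \<pi>) b = pmf \<nu> b" .
  qed
  ultimately have \<pi>: "\<pi> \<in> causal_couplings R \<mu> \<nu>"
    using z by (auto simp: causal_couplings_def p)
  have "pmf \<pi> = f" using p by auto
  then have "cost R \<rho> \<le> cost R \<pi>" if "\<rho> \<in> causal_couplings R \<mu> \<nu>" for \<rho>
    using pmfW[OF that] pmfW[OF \<pi>] f(2) by auto
  then have "ell1 R \<mu> \<nu> = ereal (cost R \<pi>)"
    unfolding ell1_def by (intro antisym SUP_least SUP_upper2[OF \<pi>]) auto
  with \<pi> show ?thesis by blast
qed

end

theory Submission
  imports Defs
begin

text \<open>Couplings can be glued along a common marginal. Together with the reverse triangle inequality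
  for \<open>tau\<close> this shows that \<open>ell1\<close> is superadditive along chains of measures, while \<open>tau\<close> is
  additive along a geodesic; this gives (a) and (b). For (c), mixing a coupling with the point mass
  at the pair of base points shows that \<open>kappa_lazy \<alpha> / (1 - \<alpha>)\<close> is nondecreasing in \<open>\<alpha>\<close>. Hence the
  limit at 1 exists in the extended reals, and (c) follows by applying (b) for \<open>\<alpha>\<close> near 1.\<close>

section \<open>Time separation\<close>

lemma causal_set_refl: "causal_set C R \<Longrightarrow> x \<in> Field R \<Longrightarrow> (x, x) \<in> R"
  unfolding causal_set_def partial_order_on_def preorder_on_def refl_on_def Field_def by blast

lemma causal_set_trans: "causal_set C R \<Longrightarrow> (x, y) \<in> R \<Longrightarrow> (y, z) \<in> R \<Longrightarrow> (x, z) \<in> R"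
  unfolding causal_set_def partial_order_on_def preorder_on_def by (blast dest: transD)

lemma causal_set_antisym: "causal_set C R \<Longrightarrow> (x, y) \<in> R \<Longrightarrow> (y, x) \<in> R \<Longrightarrow> x = y"
  unfolding causal_set_def partial_order_on_def by (blast dest: antisymD)

lemma finite_diamond:
  assumes "causal_set C R"
  shows "finite (diamond R x z)"
proof (cases "diamond R x z = {}")
  case False
  then have "x \<in> C" "z \<in> C"
    using assms by (auto simp: causal_set_def partial_order_on_def preorder_on_def diamond_def)
  then show ?thesis using assms by (auto simp: causal_set_def)
qed simp

lemma diamond_subset_Field: "diamond R x z \<subseteq> Field R"
  by (auto simp: diamond_def Field_def)

lemma chain_rel:
  assumes "causal_set C R" "chain R l z" "i \<le> j" "j \<le> l"
  shows "(z i, z j) \<in> R"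
  using assms(3,4)
proof (induction j rule: dec_induct)
  case base
  then show ?case using assms causal_set_refl[OF assms(1)] by (auto simp: chain_def)
next
  case (step j)
  then have "(z i, z j) \<in> R" "(z j, z (Suc j)) \<in> R" using assms by (auto simp: chain_def)
  then show ?case by (rule causal_set_trans[OF assms(1)])
qed

text \<open>If two points of a chain coincided, the point \<open>z (Suc i)\<close> would be squeezed
  between equal elements, so antisymmetry would force \<open>z i = z (Suc i)\<close>.\<close>

lemma chain_neq:
  assumes "causal_set C R" "chain R l z" "i < j" "j \<le> l"
  shows "z i \<noteq> z j"
proof
  assume "z i = z j"
  moreover have "(z i, z (Suc i)) \<in> R" "z i \<noteq> z (Suc i)" using assms by (auto simp: chain_def)
  moreover have "(z (Suc i), z j) \<in> R" using assms by (intro chain_rel) auto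
  ultimately show False using causal_set_antisym[OF assms(1)] by metis
qed

text \<open>The \<open>l + 1\<close> points of the chain are distinct and lie in the diamond of its
  endpoints. Finite diamonds thus bound chain lengths, so that the \<open>Max\<close> in
  \<open>tau\<close> is over a finite set.\<close>

lemma chain_length_less_card:
  assumes "causal_set C R" "chain R l z" "z 0 = x" "z l = y"
  shows "l < card (diamond R x y)"
proof -
  have "inj_on z {..l}"
    using chain_neq[OF assms(1,2)] by (intro linorder_inj_onI) auto
  moreover have "z ` {..l} \<subseteq> diamond R x y"
    using chain_rel[OF assms(1,2)] assms(3,4) by (fastforce simp: diamond_def)
  ultimately have "card {..l} \<le> card (diamond R x y)"
    by (metis card_image card_mono finite_diamond[OF assms(1)])
  then show ?thesis by simp
qed

lemma finite_chain_lengths: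
  assumes "causal_set C R"
  shows "finite {l. \<exists>z. chain R l z \<and> z 0 = x \<and> z l = y}"
  using chain_length_less_card[OF assms] by (auto intro: finite_subset[of _ "{..<card (diamond R x y)}"])

lemma chain_le_tau:
  assumes "causal_set C R" "chain R l z"
  shows "l \<le> tau R (z 0) (z l)"
  using chain_rel[OF assms, of 0 l] finite_chain_lengths[OF assms(1)] assms(2)
  by (auto simp: tau_def intro!: Max_ge)

lemma tau_attained:
  assumes C: "causal_set C R" and xy: "(x, y) \<in> R"
  obtains z where "chain R (tau R x y) z" "z 0 = x" "z (tau R x y) = y"
proof -
  let ?L = "{l. \<exists>z. chain R l z \<and> z 0 = x \<and> z l = y}"
  \<comment> \<open>\<open>Max\<close> also needs a nonempty set: the chain is the single point
    \<open>x\<close> if \<open>x = y\<close>, and the one step from \<open>x\<close> to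
    \<open>y\<close> otherwise.\<close>
  have "(if x = y then 0 else 1) \<in> ?L"
    using xy by (auto simp: chain_def Field_def le_Suc_eq intro!: exI[of _ "\<lambda>i. if i = 0 then x else y"])
  then have "Max ?L \<in> ?L" by (intro Max_in finite_chain_lengths[OF C]) auto
  then show ?thesis using xy that by (auto simp: tau_def)
qed

text \<open>Reverse triangle inequality: maximal chains from \<open>x\<close> to \<open>y\<close>
  and from \<open>y\<close> to \<open>z\<close> concatenate to a chain from \<open>x\<close> to
  \<open>z\<close>.\<close>

lemma tau_superadditive:
  assumes C: "causal_set C R" and xy: "(x, y) \<in> R" and yz: "(y, z) \<in> R"
  shows "tau R x y + tau R y z \<le> tau R x z"
proof -
  let ?l = "tau R x y" and ?l' = "tau R y z"
  obtain u where u: "chain R ?l u" "u 0 = x" "u ?l = y" using tau_attained[OF C xy] .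
  obtain v where v: "chain R ?l' v" "v 0 = y" "v ?l' = z" using tau_attained[OF C yz] .
  \<comment> \<open>At the junction \<open>?l\<close> both branches would give \<open>y\<close>, so
    a step starting there can be read off from \<open>v\<close>.\<close>
  define w where "w i = (if i \<le> ?l then u i else v (i - ?l))" for i
  have "(w i, w (Suc i)) \<in> R \<and> w i \<noteq> w (Suc i)" if "i < ?l + ?l'" for i
  proof (cases "i < ?l")
    case True
    then show ?thesis using u by (auto simp: w_def chain_def)
  next
    case False
    moreover have "w i = v (i - ?l)" using False u(3) v(2) by (cases "i = ?l") (auto simp: w_def)
    ultimately show ?thesis using v that by (auto simp: w_def chain_def Suc_diff_le)
  qed
  moreover have "w i \<in> Field R" if "i \<le> ?l + ?l'" for i
    using u v that by (auto simp: w_def chain_def)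
  ultimately have "chain R (?l + ?l') w" by (simp add: chain_def)
  moreover have "w 0 = x" "w (?l + ?l') = z"
    using u v by (auto simp: w_def)
  ultimately show ?thesis using chain_le_tau[OF C] by metis
qed

text \<open>The points \<gamma> i and \<gamma> j cut the geodesic into three pieces. Each has
  \<open>tau\<close> at least its length, and by superadditivity the three values sum to at most
  \<open>l\<close>, so equality holds in each piece.\<close>

lemma tau_geodesic:
  assumes C: "causal_set C R" and g: "geodesic R l \<gamma>" and ij: "i \<le> j" "j \<le> l"
  shows "tau R (\<gamma> i) (\<gamma> j) = j - i"
proof -
  have ch: "chain R l \<gamma>" and l: "tau R (\<gamma> 0) (\<gamma> l) = l" using g by (auto simp: geodesic_def)
  have ge: "b - a \<le> tau R (\<gamma> a) (\<gamma> b)" if "a \<le> b" "b \<le> l" for a b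
  proof -
    have "chain R (b - a) (\<lambda>i. \<gamma> (a + i))" using ch that by (auto simp: chain_def)
    from chain_le_tau[OF C this] show ?thesis using that by simp
  qed
  have "tau R (\<gamma> 0) (\<gamma> i) + tau R (\<gamma> i) (\<gamma> j) \<le> tau R (\<gamma> 0) (\<gamma> j)"
       "tau R (\<gamma> 0) (\<gamma> j) + tau R (\<gamma> j) (\<gamma> l) \<le> tau R (\<gamma> 0) (\<gamma> l)"
    using ij by (auto intro!: tau_superadditive[OF C] chain_rel[OF C ch])
  then show ?thesis using l ge[of 0 i] ge[of i j] ge[of j l] ij by linarith
qed

section \<open>Causal couplings\<close>

lemma causal_couplings_iff:
  "\<pi> \<in> causal_couplings R \<mu> \<nu> \<longleftrightarrow> map_pmf fst \<pi> = \<mu> \<and> map_pmf snd \<pi> = \<nu> \<and> set_pmf \<pi> \<subseteq> R"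
  unfolding causal_couplings_def by (auto simp: set_pmf_iff subset_iff)

lemma finite_set_pmf_coupling:
  assumes "\<pi> \<in> causal_couplings R \<mu> \<nu>" "finite (set_pmf \<mu>)" "finite (set_pmf \<nu>)"
  shows "finite (set_pmf \<pi>)"
proof -
  have "set_pmf \<pi> \<subseteq> set_pmf \<mu> \<times> set_pmf \<nu>"
    using assms(1) by (force simp: causal_couplings_iff)
  then show ?thesis using assms(2,3) by (meson finite_SigmaI finite_subset)
qed

text \<open>The supremum is attained once a causal coupling exists, so a real lower bound is
  witnessed by a single coupling. This replaces inequalities in \<open>ereal\<close> by existence
  statements.\<close>

lemma le_ell1_iff:
  assumes "finite (set_pmf \<mu>)" "finite (set_pmf \<nu>)"
  shows "ereal L \<le> ell1 R \<mu> \<nu> \<longleftrightarrow> (\<exists>\<pi>\<in>causal_couplings R \<mu> \<nu>. L \<le> cost R \<pi>)"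
proof
  assume L: "ereal L \<le> ell1 R \<mu> \<nu>"
  \<comment> \<open>Without couplings the supremum would be minus infinity, which no real number
    bounds from below.\<close>
  then have "causal_couplings R \<mu> \<nu> \<noteq> {}" by (auto simp: ell1_def bot_ereal_def)
  from ell1_attained[OF assms this] L show "\<exists>\<pi>\<in>causal_couplings R \<mu> \<nu>. L \<le> cost R \<pi>" by auto
qed (auto simp: ell1_def intro: SUP_upper2)

text \<open>Gluing: a joint law of \<pi> and \<rho> whose middle coordinates agree is projected to
  the outer coordinates. Transitivity makes the result causal, and the reverse triangle inequality
  holds pointwise on the support.\<close>

lemma glue_couplings:
  assumes C: "causal_set C R"
    and \<pi>: "\<pi> \<in> causal_couplings R \<mu> \<nu>" "finite (set_pmf \<pi>)"
    and \<rho>: "\<rho> \<in> causal_couplings R \<nu> \<xi>" "finite (set_pmf \<rho>)"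
  shows "\<exists>\<sigma>\<in>causal_couplings R \<mu> \<xi>. cost R \<pi> + cost R \<rho> \<le> cost R \<sigma>"
proof -
  \<comment> \<open>Equality of the shared marginal, read as a lifted relation and pulled back to
    \<pi> and \<rho>, yields the joint law \<open>T\<close> directly, without conditional
    probabilities.\<close>
  have "rel_pmf (=) (map_pmf snd \<pi>) (map_pmf fst \<rho>)"
    using \<pi> \<rho> by (simp add: pmf.rel_eq causal_couplings_iff)
  then have "rel_pmf (\<lambda>p q. snd p = fst q) \<pi> \<rho>" by (simp add: pmf.rel_map)
  then obtain T where T: "\<And>p q. (p, q) \<in> set_pmf T \<Longrightarrow> snd p = fst q"
    "map_pmf fst T = \<pi>" "map_pmf snd T = \<rho>"
    by (auto elim!: rel_pmf.cases)
  have supp: "set_pmf T \<subseteq> set_pmf \<pi> \<times> set_pmf \<rho>" using T(2,3) by force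
  have [simp]: "integrable T f" for f :: "_ \<Rightarrow> real"
    using supp \<pi>(2) \<rho>(2)
    by (intro integrable_measure_pmf_finite) (meson finite_SigmaI finite_subset)
  let ?t = "\<lambda>(a, b). real (tau R a b)"
  define \<sigma> where "\<sigma> = map_pmf (\<lambda>(p, q). (fst p, snd q)) T"
  have "cost R \<pi> + cost R \<rho> = measure_pmf.expectation T (\<lambda>x. ?t (fst x) + ?t (snd x))"
    unfolding cost_def T(2,3)[symmetric] by simp
  also have "\<dots> \<le> measure_pmf.expectation T (\<lambda>(p, q). ?t (fst p, snd q))"
  proof (intro integral_mono_AE)
    show "AE x in T. ?t (fst x) + ?t (snd x) \<le> (case x of (p, q) \<Rightarrow> ?t (fst p, snd q))"
    proof (intro AE_pmfI)
      fix x assume x: "x \<in> set_pmf T"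
      obtain a b b' c where x': "x = ((a, b), (b', c))" by (metis surj_pair)
      then have "b = b'" using x T(1)[of "(a, b)" "(b', c)"] by simp
      moreover have "(a, b) \<in> R" "(b', c) \<in> R"
        using x x' supp \<pi> \<rho> by (auto simp: causal_couplings_iff)
      ultimately have "x = ((a, b), (b, c))" "(a, b) \<in> R" "(b, c) \<in> R" using x' by simp_all
      then show "?t (fst x) + ?t (snd x) \<le> (case x of (p, q) \<Rightarrow> ?t (fst p, snd q))"
        using tau_superadditive[OF C, of a b c] by simp
    qed
  qed simp_all
  also have "\<dots> = cost R \<sigma>" by (simp add: cost_def \<sigma>_def case_prod_unfold)
  finally have "cost R \<pi> + cost R \<rho> \<le> cost R \<sigma>" .
  moreover have "map_pmf fst \<sigma> = map_pmf fst \<pi>" "map_pmf snd \<sigma> = map_pmf snd \<rho>"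
    unfolding \<sigma>_def T(2,3)[symmetric] by (simp_all add: pmf.map_comp o_def case_prod_beta)
  moreover have "set_pmf \<sigma> \<subseteq> R"
  proof
    fix x assume "x \<in> set_pmf \<sigma>"
    then obtain a b b' c where x: "((a, b), (b', c)) \<in> set_pmf T" "x = (a, c)"
      by (auto simp: \<sigma>_def)
    then have "b = b'" using T(1)[of "(a, b)" "(b', c)"] by simp
    moreover have "(a, b) \<in> R" "(b', c) \<in> R"
      using x supp \<pi> \<rho> by (auto simp: causal_couplings_iff)
    ultimately show "x \<in> R" using causal_set_trans[OF C] x(2) by blast
  qed
  ultimately show ?thesis using \<pi> \<rho> by (auto simp: causal_couplings_iff)
qed

text \<open>Real lower bounds \<open>L\<close> and \<open>L'\<close> stand in for the values of
  \<open>ell1\<close>, so no sum of infinite values arises.\<close>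

lemma ell1_superadditive:
  assumes "causal_set C R" "finite (set_pmf \<mu>)" "finite (set_pmf \<nu>)" "finite (set_pmf \<xi>)"
    and "ereal L \<le> ell1 R \<mu> \<nu>" "ereal L' \<le> ell1 R \<nu> \<xi>"
  shows "ereal (L + L') \<le> ell1 R \<mu> \<xi>"
proof -
  obtain \<pi> \<rho> where \<pi>: "\<pi> \<in> causal_couplings R \<mu> \<nu>" "L \<le> cost R \<pi>"
    and \<rho>: "\<rho> \<in> causal_couplings R \<nu> \<xi>" "L' \<le> cost R \<rho>"
    using assms by (auto simp: le_ell1_iff)
  obtain \<sigma> where "\<sigma> \<in> causal_couplings R \<mu> \<xi>" "cost R \<pi> + cost R \<rho> \<le> cost R \<sigma>"
    using glue_couplings[OF assms(1)] finite_set_pmf_coupling assms \<pi>(1) \<rho>(1) by meson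
  then show ?thesis using assms \<pi>(2) \<rho>(2) by (force simp: le_ell1_iff)
qed

text \<open>The diagonal coupling is causal by reflexivity. This is the base case for summing along
  a chain of measures.\<close>

lemma ell1_same_nonneg:
  assumes "causal_set C R" "finite (set_pmf \<mu>)" "set_pmf \<mu> \<subseteq> Field R"
  shows "ereal 0 \<le> ell1 R \<mu> \<mu>"
proof -
  have "map_pmf (\<lambda>x. (x, x)) \<mu> \<in> causal_couplings R \<mu> \<mu>"
    using assms(3) causal_set_refl[OF assms(1)]
    by (auto simp: causal_couplings_iff pmf.map_comp o_def)
  moreover have "0 \<le> cost R (map_pmf (\<lambda>x. (x, x)) \<mu>)" by (simp add: cost_def)
  ultimately show ?thesis using assms(2) by (auto simp: le_ell1_iff)
qed

lemma ell1_sum: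
  assumes C: "causal_set C R" and fin: "\<And>i. i \<le> k \<Longrightarrow> finite (set_pmf (\<mu> i))"
    and supp: "set_pmf (\<mu> 0) \<subseteq> Field R"
    and L: "\<And>i. i < k \<Longrightarrow> ereal (L i) \<le> ell1 R (\<mu> i) (\<mu> (Suc i))"
  shows "ereal (\<Sum>i<k. L i) \<le> ell1 R (\<mu> 0) (\<mu> k)"
  using fin L
proof (induction k)
  case 0
  then show ?case using ell1_same_nonneg[OF C _ supp] by simp
next
  case (Suc k)
  have "ereal ((\<Sum>i<k. L i) + L k) \<le> ell1 R (\<mu> 0) (\<mu> (Suc k))"
    by (rule ell1_superadditive[OF C, where \<nu> = "\<mu> k"]) (use Suc in auto)
  then show ?case by simp
qed

section \<open>Curvature along a geodesic\<close>

lemma ereal_le_quotient_minus_1_iff: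
  assumes "0 < t"
  shows "ereal K \<le> E / ereal t - 1 \<longleftrightarrow> ereal ((K + 1) * t) \<le> E"
proof (cases E)
  case (real e)
  then show ?thesis using assms by (simp add: one_ereal_def le_diff_eq pos_le_divide_eq)
qed (use assms in \<open>auto simp: one_ereal_def\<close>)

text \<open>A curvature bound \<open>K\<close> on a segment says that \<open>ell1\<close> is at
  least \<open>K + 1\<close> times its length; these bounds add up and the lengths telescope to
  \<open>n\<close>. The family \<mu> is left general to serve both the uniform and the lazy
  measures.\<close>

lemma curvature_concatenation:
  fixes m :: "nat \<Rightarrow> nat"
  assumes C: "causal_set C R" and g: "geodesic R l \<gamma>" and n: "1 \<le> n" "n \<le> l"
    and m: "m 0 = 0" "m k = n" "\<And>i. i \<in> {1..k} \<Longrightarrow> m (i - 1) < m i"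
    and \<mu>: "\<And>j. j \<le> n \<Longrightarrow> finite (set_pmf (\<mu> j)) \<and> set_pmf (\<mu> j) \<subseteq> Field R"
    and K: "\<And>i. i \<in> {1..k} \<Longrightarrow> ereal K \<le>
      ell1 R (\<mu> (m (i - 1))) (\<mu> (m i)) / ereal (real (tau R (\<gamma> (m (i - 1))) (\<gamma> (m i)))) - 1"
  shows "ereal K \<le> ell1 R (\<mu> 0) (\<mu> n) / ereal (real (tau R (\<gamma> 0) (\<gamma> n))) - 1"
proof -
  have step: "m i < m (Suc i)" if "i < k" for i using m(3)[of "Suc i"] that by simp
  \<comment> \<open>The induction runs downwards from \<open>m k = n\<close>.\<close>
  have le: "m i \<le> n" if "i \<le> k" for i
    using that
  proof (induction i rule: inc_induct)
    case (step i)
    then show ?case using m(3)[of "Suc i"] by simp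
  qed (simp add: m)
  have "ereal ((K + 1) * (real (m (Suc i)) - real (m i))) \<le> ell1 R (\<mu> (m i)) (\<mu> (m (Suc i)))"
    if "i < k" for i
  proof -
    have "tau R (\<gamma> (m i)) (\<gamma> (m (Suc i))) = m (Suc i) - m i"
      using step[OF that] le[of "Suc i"] that n by (intro tau_geodesic[OF C g]) auto
    then show ?thesis
      using K[of "Suc i"] step[OF that] that
      by (simp add: ereal_le_quotient_minus_1_iff of_nat_diff)
  qed
  then have "ereal (\<Sum>i<k. (K + 1) * (real (m (Suc i)) - real (m i))) \<le> ell1 R (\<mu> (m 0)) (\<mu> (m k))"
    using \<mu> le by (intro ell1_sum[OF C]) auto
  also have "(\<Sum>i<k. (K + 1) * (real (m (Suc i)) - real (m i))) = (K + 1) * real n"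
    by (simp add: sum_distrib_left[symmetric] sum_lessThan_telescope[of "\<lambda>i. real (m i)"] m)
  finally show ?thesis
    using tau_geodesic[OF C g, of 0 n] n m by (simp add: ereal_le_quotient_minus_1_iff)
qed

text \<open>Both endpoints lie in the diamond and differ because \<open>r\<close> is positive. These
  are the conditions under which \<open>pmf_lazy\<close> describes the lazy measure.\<close>

lemma two_le_card_diamond:
  assumes C: "causal_set C R" and ch: "chain R l \<gamma>" and r: "1 \<le> r" "s + r \<le> l"
  shows "\<gamma> s \<in> diamond R (\<gamma> s) (\<gamma> (s + r))" "2 \<le> card (diamond R (\<gamma> s) (\<gamma> (s + r)))"
proof -
  let ?D = "diamond R (\<gamma> s) (\<gamma> (s + r))"
  show *: "\<gamma> s \<in> ?D" using r by (auto simp: diamond_def intro!: chain_rel[OF C ch])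
  have "\<gamma> (s + r) \<in> ?D" using r by (auto simp: diamond_def intro!: chain_rel[OF C ch])
  moreover have "\<gamma> s \<noteq> \<gamma> (s + r)" using r by (intro chain_neq[OF C ch]) auto
  ultimately show "2 \<le> card ?D"
    using * card_mono[OF finite_diamond[OF C], of "{\<gamma> s, \<gamma> (s + r)}" "\<gamma> s" "\<gamma> (s + r)"] by simp
qed

lemma set_pmf_lazy_subset:
  assumes "finite A" "x \<in> A" "2 \<le> card A" "0 \<le> \<alpha>" "\<alpha> \<le> 1"
  shows "set_pmf (lazy_pmf \<alpha> x A) \<subseteq> A"
proof
  fix z assume "z \<in> set_pmf (lazy_pmf \<alpha> x A)"
  then show "z \<in> A"
    using assms(2) by (cases "z \<in> A") (auto simp: set_pmf_iff pmf_lazy[OF assms] indicator_def)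
qed

lemma kappa_concatenation:
  fixes m :: "nat \<Rightarrow> nat"
  assumes C: "causal_set C R" and n: "1 \<le> n" and g: "geodesic R (n + r) \<gamma>"
    and m: "m 0 = 0" "m k = n" "\<And>i. i \<in> {1..k} \<Longrightarrow> m (i - 1) < m i"
    and K: "\<And>i. i \<in> {1..k} \<Longrightarrow>
      ereal K \<le> kappa R r (m i - m (i - 1)) (subgeodesic \<gamma> (m (i - 1)))"
  shows "ereal K \<le> kappa R r n \<gamma>"
proof -
  let ?D = "\<lambda>j. diamond R (\<gamma> j) (\<gamma> (j + r))"
  let ?\<mu> = "\<lambda>j. pmf_of_set (?D j)"
  have "?D j \<noteq> {}" if "j \<le> n" for j
    using that g chain_rel[OF C, of "n + r" \<gamma> j j] chain_rel[OF C, of "n + r" \<gamma> j "j + r"]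
    by (auto simp: diamond_def geodesic_def)
  then have fin: "finite (set_pmf (?\<mu> j)) \<and> set_pmf (?\<mu> j) \<subseteq> Field R" if "j \<le> n" for j
    using that diamond_subset_Field finite_diamond[OF C] by (simp add: set_pmf_of_set)
  have "ereal K \<le> ell1 R (?\<mu> (m (i - 1))) (?\<mu> (m i))
      / ereal (real (tau R (\<gamma> (m (i - 1))) (\<gamma> (m i)))) - 1" if "i \<in> {1..k}" for i
  proof -
    \<comment> \<open>The target measure of the subgeodesic thus sits at \<gamma> (m i), where the
      next one has its source measure; both use the same \<open>r\<close>.\<close>
    have "m (i - 1) + (m i - m (i - 1)) = m i" using m(3)[OF that] by simp
    then show ?thesis
      using K[OF that] by (simp add: kappa_def subgeodesic_def add.assoc[symmetric])
  qed
  then have "ereal K \<le> ell1 R (?\<mu> 0) (?\<mu> n) / ereal (real (tau R (\<gamma> 0) (\<gamma> n))) - 1"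
    using fin m by (intro curvature_concatenation[OF C g n, where \<mu> = ?\<mu> and m = m and k = k]) auto
  then show ?thesis by (simp add: kappa_def)
qed

lemma kappa_lazy_concatenation:
  fixes m :: "nat \<Rightarrow> nat"
  assumes C: "causal_set C R" and n: "1 \<le> n" "1 \<le> r" and g: "geodesic R (n + r) \<gamma>"
    and m: "m 0 = 0" "m k = n" "\<And>i. i \<in> {1..k} \<Longrightarrow> m (i - 1) < m i"
    and \<alpha>: "0 \<le> \<alpha>" "\<alpha> \<le> 1"
    and K: "\<And>i. i \<in> {1..k} \<Longrightarrow>
      ereal K \<le> kappa_lazy R r \<alpha> (m i - m (i - 1)) (subgeodesic \<gamma> (m (i - 1)))"
  shows "ereal K \<le> kappa_lazy R r \<alpha> n \<gamma>"
proof -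
  let ?D = "\<lambda>j. diamond R (\<gamma> j) (\<gamma> (j + r))"
  let ?\<mu> = "\<lambda>j. lazy_pmf \<alpha> (\<gamma> j) (?D j)"
  have ch: "chain R (n + r) \<gamma>" using g by (simp add: geodesic_def)
  have fin: "finite (set_pmf (?\<mu> j)) \<and> set_pmf (?\<mu> j) \<subseteq> Field R" if "j \<le> n" for j
  proof -
    have "set_pmf (?\<mu> j) \<subseteq> ?D j"
      using two_le_card_diamond[OF C ch n(2), of j] that \<alpha>
      by (intro set_pmf_lazy_subset finite_diamond[OF C]) auto
    then show ?thesis using diamond_subset_Field finite_diamond[OF C] by (meson finite_subset order_trans)
  qed
  have "ereal K \<le> ell1 R (?\<mu> (m (i - 1))) (?\<mu> (m i))
      / ereal (real (tau R (\<gamma> (m (i - 1))) (\<gamma> (m i)))) - 1" if "i \<in> {1..k}" for i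
  proof -
    have "m (i - 1) + (m i - m (i - 1)) = m i" using m(3)[OF that] by simp
    then show ?thesis
      using K[OF that] by (simp add: kappa_lazy_def subgeodesic_def add.assoc[symmetric])
  qed
  then have "ereal K \<le> ell1 R (?\<mu> 0) (?\<mu> n) / ereal (real (tau R (\<gamma> 0) (\<gamma> n))) - 1"
    using fin m by (intro curvature_concatenation[OF C g n(1), where \<mu> = ?\<mu> and m = m and k = k]) auto
  then show ?thesis by (simp add: kappa_lazy_def)
qed

section \<open>The limit curvature\<close>

text \<open>Raising the idleness from \<alpha> to \<beta> amounts to moving to the base point with
  probability \<open>1 - t\<close>. The weight \<open>t\<close> is the ratio of the masses off the
  base point.\<close>

lemma lazy_pmf_mixture:
  assumes A: "finite A" "x \<in> A" "2 \<le> card A" and \<alpha>: "0 \<le> \<alpha>" "\<alpha> \<le> \<beta>" "\<beta> \<le> 1" "\<alpha> < 1"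
    and t: "t = (1 - \<beta>) / (1 - \<alpha>)"
  shows "bernoulli_pmf t \<bind> (\<lambda>b. if b then lazy_pmf \<alpha> x A else return_pmf x) = lazy_pmf \<beta> x A"
proof (rule pmf_eqI)
  fix z
  have t01: "0 \<le> t" "t \<le> 1" and t\<alpha>: "t * (1 - \<alpha>) = 1 - \<beta>" using \<alpha> by (auto simp: t)
  have \<beta>: "\<beta> = t * \<alpha> + (1 - t)" using t\<alpha> by (simp add: algebra_simps)
  have 1: "pmf (lazy_pmf \<alpha> x A) z =
      \<alpha> * indicator {x} z + (1 - \<alpha>) / (real (card A) - 1) * indicator (A - {x}) z"
    using A \<alpha> by (intro pmf_lazy) auto
  have 2: "pmf (lazy_pmf \<beta> x A) z =
      \<beta> * indicator {x} z + (t * (1 - \<alpha>)) / (real (card A) - 1) * indicator (A - {x}) z"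
    unfolding t\<alpha> using A \<alpha> by (intro pmf_lazy) auto
  have "pmf (bernoulli_pmf t \<bind> (\<lambda>b. if b then lazy_pmf \<alpha> x A else return_pmf x)) z =
      t * pmf (lazy_pmf \<alpha> x A) z + (1 - t) * indicator {x} z"
    using t01 by (simp add: pmf_bind pmf_return indicator_def)
  also have "\<dots> = pmf (lazy_pmf \<beta> x A) z"
    unfolding 1 2 by (subst \<beta>) (simp add: indicator_def)
  finally show "pmf (bernoulli_pmf t \<bind> (\<lambda>b. if b then lazy_pmf \<alpha> x A else return_pmf x)) z =
      pmf (lazy_pmf \<beta> x A) z" .
qed

text \<open>The same coin is used for both marginals: one outcome draws from \<pi>, the other gives
  the fixed pair \<open>(x, y)\<close>. The cost is therefore affine in \<open>t\<close>.\<close>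

lemma mixed_coupling:
  assumes \<pi>: "\<pi> \<in> causal_couplings R \<mu> \<nu>" "finite (set_pmf \<pi>)" and xy: "(x, y) \<in> R"
    and t: "0 \<le> t" "t \<le> 1"
  shows "\<exists>\<sigma>\<in>causal_couplings R (bernoulli_pmf t \<bind> (\<lambda>b. if b then \<mu> else return_pmf x))
                              (bernoulli_pmf t \<bind> (\<lambda>b. if b then \<nu> else return_pmf y)).
           cost R \<sigma> = t * cost R \<pi> + (1 - t) * real (tau R x y)"
proof
  define \<sigma> where "\<sigma> = bernoulli_pmf t \<bind> (\<lambda>b. if b then \<pi> else return_pmf (x, y))"
  show "\<sigma> \<in> causal_couplings R (bernoulli_pmf t \<bind> (\<lambda>b. if b then \<mu> else return_pmf x))
                              (bernoulli_pmf t \<bind> (\<lambda>b. if b then \<nu> else return_pmf y))"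
    using \<pi> xy
    by (auto simp: causal_couplings_iff \<sigma>_def map_bind_pmf if_distrib split: if_splits
        intro!: bind_pmf_cong)
  show "cost R \<sigma> = t * cost R \<pi> + (1 - t) * real (tau R x y)"
    unfolding cost_def \<sigma>_def
    by (subst pmf_expectation_bind[where A = UNIV]) (use \<pi>(2) t in \<open>auto simp: UNIV_bool\<close>)
qed

lemma ereal_le_divide_iff:
  assumes "0 < t"
  shows "ereal K \<le> E / ereal t \<longleftrightarrow> ereal (K * t) \<le> E"
  using assms by (cases E) (auto simp: pos_le_divide_eq)

text \<open>A coupling for \<alpha> is mixed with the point mass at the base points. That pair has
  cost \<open>n\<close>, that is curvature zero, so the curvature bound shrinks by exactly the
  factor \<open>(1 - \<beta>) / (1 - \<alpha>)\<close>, and the quotient by one minus the idleness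
  keeps its bound.\<close>

lemma kappa_lazy_slope_mono:
  assumes C: "causal_set C R" and n: "1 \<le> n" "1 \<le> r" and g: "geodesic R (n + r) \<gamma>"
    and \<alpha>: "0 \<le> \<alpha>" "\<alpha> \<le> \<beta>" "\<beta> < 1"
  shows "kappa_lazy R r \<alpha> n \<gamma> / ereal (1 - \<alpha>) \<le> kappa_lazy R r \<beta> n \<gamma> / ereal (1 - \<beta>)"
proof -
  have ch: "chain R (n + r) \<gamma>" using g by (simp add: geodesic_def)
  let ?D = "\<lambda>j. diamond R (\<gamma> j) (\<gamma> (j + r))"
  let ?\<mu> = "\<lambda>\<alpha> j. lazy_pmf \<alpha> (\<gamma> j) (?D j)"
  note D = finite_diamond[OF C, of "\<gamma> j" "\<gamma> (j + r)" for j] two_le_card_diamond[OF C ch n(2)]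
  have fin: "finite (set_pmf (?\<mu> a j))" if "j \<le> n" "0 \<le> a" "a \<le> 1" for a j
    using set_pmf_lazy_subset[OF D, of j a] that D(1) by (meson finite_subset add_le_mono1)
  have tau: "tau R (\<gamma> 0) (\<gamma> n) = n" using tau_geodesic[OF C g, of 0 n] by simp
  have slope: "ereal K \<le> kappa_lazy R r a n \<gamma> / ereal (1 - a) \<longleftrightarrow>
      (\<exists>\<pi>\<in>causal_couplings R (?\<mu> a 0) (?\<mu> a n). (K * (1 - a) + 1) * real n \<le> cost R \<pi>)"
    if "0 \<le> a" "a < 1" for K a
    using that n fin[of 0 a] fin[of n a]
    by (simp add: ereal_le_divide_iff kappa_lazy_def tau ereal_le_quotient_minus_1_iff le_ell1_iff)
  have real_le: "ereal K \<le> kappa_lazy R r \<beta> n \<gamma> / ereal (1 - \<beta>)"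
    if K: "ereal K \<le> kappa_lazy R r \<alpha> n \<gamma> / ereal (1 - \<alpha>)" for K
  proof -
    obtain \<pi> where \<pi>: "\<pi> \<in> causal_couplings R (?\<mu> \<alpha> 0) (?\<mu> \<alpha> n)"
      "(K * (1 - \<alpha>) + 1) * real n \<le> cost R \<pi>"
      using slope[of \<alpha> K] K \<alpha> by (meson le_less_trans)
    define t where "t = (1 - \<beta>) / (1 - \<alpha>)"
    have t: "0 \<le> t" "t \<le> 1" "t * (1 - \<alpha>) = 1 - \<beta>" using \<alpha> by (auto simp: t_def)
    have "(\<gamma> 0, \<gamma> n) \<in> R" by (rule chain_rel[OF C ch]) auto
    moreover have "finite (set_pmf \<pi>)"
      by (rule finite_set_pmf_coupling[OF \<pi>(1)]) (rule fin; use \<alpha> in simp)+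
    moreover have "bernoulli_pmf t \<bind> (\<lambda>b. if b then ?\<mu> \<alpha> j else return_pmf (\<gamma> j)) = ?\<mu> \<beta> j"
      if "j \<le> n" for j
      using that \<alpha> t_def D by (intro lazy_pmf_mixture) auto
    ultimately obtain \<sigma> where \<sigma>: "\<sigma> \<in> causal_couplings R (?\<mu> \<beta> 0) (?\<mu> \<beta> n)"
      "cost R \<sigma> = t * cost R \<pi> + (1 - t) * real n"
      using mixed_coupling[OF \<pi>(1), of "\<gamma> 0" "\<gamma> n" t] t tau by auto
    have "(K * (1 - \<beta>) + 1) * real n = t * ((K * (1 - \<alpha>) + 1) * real n) + (1 - t) * real n"
      unfolding t(3)[symmetric] by (simp add: algebra_simps)
    also have "\<dots> \<le> cost R \<sigma>" using \<pi>(2) t by (simp add: \<sigma>(2) mult_left_mono)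
    finally show ?thesis using \<sigma>(1) slope[of \<beta> K] \<alpha> by (meson order_trans)
  qed
  \<comment> \<open>Real lower bounds suffice, even for infinite quotients: if the inequality
    failed, some real \<open>K\<close> would lie strictly between the two sides.\<close>
  show ?thesis
  proof (rule ccontr)
    assume "\<not> ?thesis"
    then obtain K where "kappa_lazy R r \<beta> n \<gamma> / ereal (1 - \<beta>) < ereal K"
      "ereal K < kappa_lazy R r \<alpha> n \<gamma> / ereal (1 - \<alpha>)"
      using ereal_dense2 by (meson not_le)
    then show False using real_le[of K] by (meson less_imp_le not_le)
  qed
qed

lemma mono_tendsto_at_left_SUP:
  fixes f :: "real \<Rightarrow> ereal"
  assumes "a < b" and mono: "\<And>s t. a \<le> s \<Longrightarrow> s \<le> t \<Longrightarrow> t < b \<Longrightarrow> f s \<le> f t"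
  shows "(f \<longlongrightarrow> (SUP s\<in>{a..<b}. f s)) (at_left b)"
proof (rule order_tendstoI)
  fix c assume "c < (SUP s\<in>{a..<b}. f s)"
  then obtain s where s: "s \<in> {a..<b}" "c < f s" by (auto simp: less_SUP_iff)
  have "eventually (\<lambda>t. t \<in> {s<..<b}) (at_left b)"
    using s by (intro eventually_at_left_real) auto
  then show "eventually (\<lambda>t. c < f t) (at_left b)"
    by eventually_elim (use s mono[of s] in \<open>force intro: less_le_trans\<close>)
next
  fix c assume c: "(SUP s\<in>{a..<b}. f s) < c"
  have "eventually (\<lambda>t. t \<in> {a<..<b}) (at_left b)"
    using assms by (intro eventually_at_left_real) auto
  then show "eventually (\<lambda>t. f t < c) (at_left b)"
    by eventually_elim (use c in \<open>auto intro!: le_less_trans[OF SUP_upper c]\<close>)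
qed

text \<open>\<open>Lim\<close> carries information only where a limit exists. Monotonicity supplies
  one in the extended reals, namely the supremum over idleness in \<open>{0..<1}\<close>.\<close>

lemma kappa_LLY_tendsto:
  assumes "causal_set C R" "1 \<le> n" "1 \<le> r" "geodesic R (n + r) \<gamma>"
  shows "((\<lambda>\<alpha>. kappa_lazy R r \<alpha> n \<gamma> / ereal (1 - \<alpha>)) \<longlongrightarrow> kappa_LLY R r n \<gamma>) (at_left 1)"
proof -
  let ?f = "\<lambda>\<alpha>. kappa_lazy R r \<alpha> n \<gamma> / ereal (1 - \<alpha>)"
  have "(?f \<longlongrightarrow> (SUP s\<in>{0..<1}. ?f s)) (at_left 1)"
    by (intro mono_tendsto_at_left_SUP kappa_lazy_slope_mono[OF assms]) auto
  moreover from this have "kappa_LLY R r n \<gamma> = (SUP s\<in>{0..<1}. ?f s)"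
    unfolding kappa_LLY_def by (intro tendsto_Lim) simp_all
  ultimately show ?thesis by simp
qed

lemma geodesic_subgeodesic:
  assumes "causal_set C R" "geodesic R l \<gamma>" "s + l' \<le> l"
  shows "geodesic R l' (subgeodesic \<gamma> s)"
  using assms tau_geodesic[OF assms(1,2), of s "s + l'"]
  by (auto simp: geodesic_def subgeodesic_def chain_def)

lemma kappa_LLY_concatenation:
  fixes m :: "nat \<Rightarrow> nat"
  assumes C: "causal_set C R" and n: "1 \<le> n" "1 \<le> r" and g: "geodesic R (n + r) \<gamma>"
    and m: "m 0 = 0" "m k = n" "\<And>i. i \<in> {1..k} \<Longrightarrow> m (i - 1) < m i"
    and K: "\<And>i. i \<in> {1..k} \<Longrightarrow>
      ereal K \<le> kappa_LLY R r (m i - m (i - 1)) (subgeodesic \<gamma> (m (i - 1)))"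
  shows "ereal K \<le> kappa_LLY R r n \<gamma>"
proof (rule ccontr)
  assume "\<not> ?thesis"
  \<comment> \<open>The gap below \<open>K\<close> is essential: a limit that is at least
    \<open>K\<close> keeps the quotients near 1 only above a smaller number
    \<open>L\<close>.\<close>
  then obtain L where L: "kappa_LLY R r n \<gamma> < ereal L" "ereal L < ereal K"
    using ereal_dense2 by (meson not_le)
  have le: "m i \<le> n" if "i \<le> k" for i
    using that
  proof (induction i rule: inc_induct)
    case (step i)
    then show ?case using m(3)[of "Suc i"] by simp
  qed (simp add: m)
  have "eventually (\<lambda>\<alpha>. ereal L <
      kappa_lazy R r \<alpha> (m i - m (i - 1)) (subgeodesic \<gamma> (m (i - 1))) / ereal (1 - \<alpha>)) (at_left 1)"
    if i: "i \<in> {1..k}" for i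
  proof (rule order_tendstoD(1)[OF kappa_LLY_tendsto[OF C]])
    show "geodesic R (m i - m (i - 1) + r) (subgeodesic \<gamma> (m (i - 1)))"
      using m(3)[OF i] le[of i] i by (intro geodesic_subgeodesic[OF C g]) auto
    show "ereal L < kappa_LLY R r (m i - m (i - 1)) (subgeodesic \<gamma> (m (i - 1)))"
      using L(2) K[OF i] by (rule less_le_trans)
  qed (use m(3)[OF i] n in auto)
  \<comment> \<open>Since there are finitely many subgeodesics, one left neighbourhood of 1 serves
    all of them.\<close>
  then have "eventually (\<lambda>\<alpha>. \<forall>i\<in>{1..k}. ereal L <
      kappa_lazy R r \<alpha> (m i - m (i - 1)) (subgeodesic \<gamma> (m (i - 1))) / ereal (1 - \<alpha>)) (at_left 1)"
    by (intro eventually_ball_finite) auto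
  moreover have "eventually (\<lambda>\<alpha>::real. \<alpha> \<in> {0<..<1}) (at_left 1)"
    by (rule eventually_at_left_real) simp
  ultimately have "eventually (\<lambda>\<alpha>. ereal L \<le> kappa_lazy R r \<alpha> n \<gamma> / ereal (1 - \<alpha>)) (at_left 1)"
  proof eventually_elim
    case (elim \<alpha>)
    then have "ereal (L * (1 - \<alpha>)) \<le>
        kappa_lazy R r \<alpha> (m i - m (i - 1)) (subgeodesic \<gamma> (m (i - 1)))" if "i \<in> {1..k}" for i
      using that by (subst ereal_le_divide_iff[symmetric]) (auto intro: less_imp_le)
    \<comment> \<open>The fixed-idleness statement is applied with the bound
      \<open>L * (1 - \<alpha>)\<close>, which varies with \<alpha>; dividing by
      \<open>1 - \<alpha>\<close> afterwards restores \<open>L\<close>.\<close>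
    then have "ereal (L * (1 - \<alpha>)) \<le> kappa_lazy R r \<alpha> n \<gamma>"
      using elim m by (intro kappa_lazy_concatenation[OF C n g, where m = m and k = k]) auto
    then show ?case using elim by (simp add: ereal_le_divide_iff)
  qed
  then have "ereal L \<le> kappa_LLY R r n \<gamma>"
    by (intro tendsto_lowerbound[OF kappa_LLY_tendsto[OF C n g]])
      simp_all
  with L(1) show False by simp
qed

theorem theorem3p7:
  fixes C :: "'a set" and R :: "'a rel" and \<gamma> :: "nat \<Rightarrow> 'a" and m :: "nat \<Rightarrow> nat"
    and n r k :: nat and K \<alpha> :: real
  assumes "causal_set C R"
    and "1 \<le> n" and "1 \<le> r"
    and "geodesic R (n + r) \<gamma>"
    and "m 0 = 0" and "m k = n"
    and "\<forall>i\<in>{1..k}. m (i - 1) < m i"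
    and "\<forall>i\<in>{1..k}. r \<le> m i - m (i - 1)"
    and "0 \<le> \<alpha>" and "\<alpha> \<le> 1"
  shows
    "((\<forall>i\<in>{1..k}. ereal K \<le> kappa R r (m i - m (i - 1)) (subgeodesic \<gamma> (m (i - 1))))
        \<longrightarrow> ereal K \<le> kappa R r n \<gamma>) \<and>
     ((\<forall>i\<in>{1..k}. ereal K \<le> kappa_lazy R r \<alpha> (m i - m (i - 1)) (subgeodesic \<gamma> (m (i - 1))))
        \<longrightarrow> ereal K \<le> kappa_lazy R r \<alpha> n \<gamma>) \<and>
     ((\<forall>i\<in>{1..k}. ereal K \<le> kappa_LLY R r (m i - m (i - 1)) (subgeodesic \<gamma> (m (i - 1))))
        \<longrightarrow> ereal K \<le> kappa_LLY R r n \<gamma>)"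
  using kappa_concatenation[OF assms(1,2,4), of m k K]
    kappa_lazy_concatenation[OF assms(1-4), of m k \<alpha> K]
    kappa_LLY_concatenation[OF assms(1-4), of m k K] assms(5-)
  by blast

end
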